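(* For $\lambda\ge 0$ and $x\in(0,\infty)$, let $$H_\lambda(x)=\ln\Gamma(x+1)-\Bigl(x+\frac12\Bigr)\ln\Bigl(x+\frac12\Bigr)+x+\frac12-\ln\sqrt{2\pi}+\frac1{24(x+\lambda)}.$$ Let $\lambda\ge0$. Then: (1) the function $H_\lambda$ is completely monotonic on $(0,\infty)$ if and only if $0\le\lambda\le\frac12$; (2) if $$\lambda\ge-\inf_{t\in(0,\infty)}\biggl\{\frac1t\ln\biggl[\frac{24}{t^2}\biggl(\frac1{e^{t/2}}-\frac{t}{e^t-1}\biggr)\biggr]\biggr\},$$ then the function $-H_\lambda$ is completely monotonic on $(0,\infty)$; (3) if $\lambda\ge\frac32$, which is a special case of the inequality in (2) (that is, every $\lambda\ge\frac32$ satisfies the inequality in (2)), then the function $-H_\lambda$ is completely monotonic on $(0,\infty)$.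
   Context: $\Gamma(x)=\int_0^\infty t^{x-1}e^{-t}\,dt$ for $x>0$ is the classical Euler gamma function. A function $f$ is completely monotonic on an interval $I$ if $f$ has derivatives of all orders on $I$ and $0\le(-1)^{n}f^{(n)}(x)<\infty$ for all $x\in I$ and all integers $n\ge0$. *)

theory Defs
  imports "HOL-Analysis.Analysis"
begin

text \<open>
  \<open>D n\<close> is the \<open>n\<close>-th derivative of \<open>f\<close> on \<open>I\<close>, one-sided at endpoints belonging to \<open>I\<close>.  On an
  interval with more than one point, \<open>D n\<close> is uniquely determined on \<open>I\<close>; on open \<open>I\<close> it is the
  iterated \<^const>\<open>deriv\<close>, see \<open>completely_monotonic_on_open_iff\<close> below.
  Finiteness of the derivatives is automatic, as they are real-valued.
\<close>

definition completely_monotonic_on :: "real set \<Rightarrow> (real \<Rightarrow> real) \<Rightarrow> bool" where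
  "completely_monotonic_on I f \<longleftrightarrow>
     (\<exists>D :: nat \<Rightarrow> real \<Rightarrow> real.
        (\<forall>x\<in>I. D 0 x = f x) \<and>
        (\<forall>n. \<forall>x\<in>I. (D n has_real_derivative D (Suc n) x) (at x within I)) \<and>
        (\<forall>n. \<forall>x\<in>I. 0 \<le> (-1) ^ n * D n x))"

lemma completely_monotonic_on_open_iff:
  assumes "open I"
  shows "completely_monotonic_on I f \<longleftrightarrow>
           (\<forall>n. \<forall>x\<in>I. (deriv ^^ n) f differentiable at x \<and> 0 \<le> (-1) ^ n * (deriv ^^ n) f x)"
proof
  assume "completely_monotonic_on I f"
  then obtain D where D0: "\<And>x. x \<in> I \<Longrightarrow> D 0 x = f x"
    and DS: "\<And>n x. x \<in> I \<Longrightarrow> (D n has_real_derivative D (Suc n) x) (at x within I)"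
    and pos: "\<And>n x. x \<in> I \<Longrightarrow> 0 \<le> (-1) ^ n * D n x"
    unfolding completely_monotonic_on_def by blast
  have eq: "\<forall>x\<in>I. (deriv ^^ n) f x = D n x" for n
  proof (induction n)
    case 0
    then show ?case using D0 by simp
  next
    case (Suc n)
    have "deriv ((deriv ^^ n) f) x = D (Suc n) x" if "x \<in> I" for x
    proof (rule DERIV_imp_deriv)
      have "(D n has_real_derivative D (Suc n) x) (at x)"
        using DS[OF that] at_within_open[OF that assms] by simp
      then show "((deriv ^^ n) f has_real_derivative D (Suc n) x) (at x)"
        by (rule has_field_derivative_transform_within_open[OF _ assms that]) (use Suc in auto)
    qed
    then show ?case by simp
  qed
  have "((deriv ^^ n) f has_real_derivative D (Suc n) x) (at x)" if "x \<in> I" for n x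
  proof -
    have "(D n has_real_derivative D (Suc n) x) (at x)"
      using DS[OF that] at_within_open[OF that assms] by simp
    then show ?thesis
      by (rule has_field_derivative_transform_within_open[OF _ assms that]) (use eq in auto)
  qed
  then show "\<forall>n. \<forall>x\<in>I. (deriv ^^ n) f differentiable at x \<and> 0 \<le> (-1) ^ n * (deriv ^^ n) f x"
    using pos eq by (auto simp: real_differentiable_def)
next
  assume *: "\<forall>n. \<forall>x\<in>I. (deriv ^^ n) f differentiable at x \<and> 0 \<le> (-1) ^ n * (deriv ^^ n) f x"
  have "((deriv ^^ n) f has_real_derivative (deriv ^^ Suc n) f x) (at x within I)" if "x \<in> I" for n x
  proof -
    have "(deriv ^^ n) f differentiable at x"
      using *[rule_format, OF that, of n] by (rule conjunct1)
    then obtain c where c: "((deriv ^^ n) f has_real_derivative c) (at x)"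
      by (rule real_differentiableE)
    then have "deriv ((deriv ^^ n) f) x = c" by (rule DERIV_imp_deriv)
    with c show ?thesis by (simp add: has_field_derivative_at_within)
  qed
  moreover have "0 \<le> (-1) ^ n * (deriv ^^ n) f x" if "x \<in> I" for n x
    using *[rule_format, OF that, of n] by (rule conjunct2)
  ultimately show "completely_monotonic_on I f"
    unfolding completely_monotonic_on_def
    by (intro exI[of _ "\<lambda>n. (deriv ^^ n) f"] conjI allI ballI) simp_all
qed

definition H :: "real \<Rightarrow> real \<Rightarrow> real" where
  "H l x = ln (Gamma (x + 1)) - (x + 1/2) * ln (x + 1/2) + x + 1/2 - ln (sqrt (2 * pi))
           + 1 / (24 * (x + l))"

text \<open>
  The infimum is taken in \<^typ>\<open>ereal\<close>, so that it is meaningful without a proof of boundedness.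
\<close>

definition threshold :: ereal where
  "threshold =
     - (INF t\<in>{0<..}.
          ereal (1 / t * ln (24 / t\<^sup>2 * (1 / exp (t / 2) - t / (exp t - 1)))))"

end

theory Submission
  imports Defs "HOL-Probability.Sinc_Integral" "HOL-Real_Asymp.Real_Asymp"
begin

text \<open>
  Write \<open>G\<close> for the error in Stirling's approximation centred at \<open>x + 1/2\<close>, so that
  \<open>H\<close> is \<open>G + 1 / (24 (x + l))\<close>.  Binet's formula reads
  \<open>G x = - \<integral> \<phi> t exp (- x t) dt\<close> over \<open>t > 0\<close>, where
  \<open>\<phi> t = (exp (- t / 2) - t / (exp t - 1)) / t\<^sup>2\<close>, and hence \<open>H\<close> is
  the Laplace transform of \<open>exp (- l t) / 24 - \<phi> t\<close>.  If this kernel has constant sign, then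
  \<open>H\<close> or \<open>- H\<close> is completely monotonic.  The sufficient conditions are statements about the kernel:
  it is nonnegative for \<open>l \<le> 1/2\<close> (\<open>binet_kernel_le\<close>), nonpositive exactly when \<open>l\<close> reaches the
  threshold (\<open>threshold_le_iff\<close>), and nonpositive for \<open>l \<ge> 3/2\<close> (\<open>binet_kernel_ge\<close>).

  Binet's formula itself, and differentiation under the integral, can be bypassed.  The functional
  equation of \<open>\<Gamma>\<close> makes \<open>G x - G (x + 1)\<close> elementary, and from the second derivative on this
  difference is rational.  Therefore each derivative of order \<open>n + 2\<close> of \<open>F x - F (x + 1)\<close>, for
  \<open>F x = G x + a / (x + l)\<close>, is a finite combination of Gamma integrals
  \<open>\<integral> t ^ n exp (- c t) dt = n! / c ^ (n + 1)\<close>; it equals, up to the sign \<open>(-1) ^ n\<close>, the integral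
  of \<open>t ^ (n + 2) exp (- x t) (1 - exp (- t))\<close> against the kernel
  (\<open>corrected_deriv_difference_laplace\<close>).  So a sign of the kernel is a monotonicity of the higher
  derivatives of \<open>F\<close> under \<open>x \<mapsto> x + 1\<close>.  These tend to \<open>0\<close> along \<open>x + k\<close>, which turns the
  monotonicity into a sign; orders one and zero follow by integrating the sign of the next
  derivative and using decay again.

  The decay of \<open>G\<close> is Stirling's formula.  The comparison cases \<open>a = 0\<close> and \<open>a = 1/24\<close>,
  \<open>l = 1/2\<close> of the argument, used for first derivatives only, say that \<open>G\<close> increases and is bounded;
  Legendre's duplication formula then forces the limit to be \<open>0\<close>
  (\<open>stirling_error_tendsto_0\<close>).

  Necessity in the first part: if \<open>H\<close> is completely monotonic then its second derivative decreases,
  so \<open>H'' x - H'' (x + 1) \<ge> 0\<close>.  This rational function, multiplied by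
  \<open>x ^ 5\<close>, tends to \<open>1/2 - l\<close>, whence \<open>l \<le> 1/2\<close>.
\<close>

section \<open>Derivatives\<close>

definition stirling_error :: "real \<Rightarrow> real" where
  "stirling_error x = ln (Gamma (x + 1)) - (x + 1/2) * ln (x + 1/2) + x + 1/2 - ln (sqrt (2 * pi))"

text \<open>
  The derivatives of \<open>x \<mapsto> stirling_error x + a / (x + l)\<close>.  Besides \<open>a = 1/24\<close>, the value \<open>a = 0\<close>
  is used to study the Stirling error itself.  The equations are between functions, so that they
  also rewrite unapplied occurrences under derivatives.
\<close>

fun corrected_deriv :: "real \<Rightarrow> real \<Rightarrow> nat \<Rightarrow> real \<Rightarrow> real" where
  "corrected_deriv a l 0 = (\<lambda>x. stirling_error x + a / (x + l))"
| "corrected_deriv a l (Suc 0) = (\<lambda>x. Digamma (x + 1) - ln (x + 1/2) - a / (x + l)\<^sup>2)"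
| "corrected_deriv a l (Suc (Suc n)) = (\<lambda>x.
     Polygamma (Suc n) (x + 1) - (-1) ^ n * fact n / (x + 1/2) ^ Suc n
     + a * (-1) ^ n * fact (n + 2) / (x + l) ^ (n + 3))"

lemma H_eq_corrected: "H l x = corrected_deriv (1/24) l 0 x"
  by (simp add: H_def stirling_error_def)

lemma DERIV_inverse_shift_power:
  fixes x c :: real
  assumes "x + c \<noteq> 0"
  shows "((\<lambda>x. b / (x + c) ^ n) has_real_derivative - (b * real n / (x + c) ^ Suc n)) (at x)"
proof -
  have "((\<lambda>x. b / (x + c) ^ n) has_real_derivative
      - (b * (real n * (x + c) ^ (n - 1))) / ((x + c) ^ n)\<^sup>2) (at x)"
    by (rule derivative_eq_intros refl | use assms in \<open>simp add: power2_eq_square\<close>)+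
  moreover have "- (b * (real n * (x + c) ^ (n - 1))) / ((x + c) ^ n)\<^sup>2
      = - (b * real n / (x + c) ^ Suc n)"
  proof (cases n)
    case (Suc m)
    have "- (b * (r * p)) / (d * p)\<^sup>2 = - (b * r / (d * (d * p)))" if "d \<noteq> 0" "p \<noteq> 0" for r p d :: real
      using that by (simp add: power2_eq_square)
    from this[OF assms power_not_zero[OF assms, of m]] show ?thesis by (simp add: Suc)
  qed simp
  ultimately show ?thesis by simp
qed

lemma corrected_deriv_has_derivative:
  fixes x l a :: real
  assumes "x > 0" "l \<ge> 0"
  shows "(corrected_deriv a l n has_real_derivative corrected_deriv a l (Suc n) x) (at x)"
proof -
  have nonpos: "x + 1 \<notin> \<int>\<^sub>\<le>\<^sub>0"
    using assms by (auto elim!: nonpos_Ints_cases)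
  have polygamma: "((\<lambda>x. Polygamma k (x + 1)) has_real_derivative Polygamma (Suc k) (x + 1)) (at x)" for k
    using DERIV_shift[of "Polygamma k" "Polygamma (Suc k) (x + 1)" x 1]
      has_field_derivative_Polygamma[OF nonpos, of k UNIV] by simp
  consider "n = 0" | "n = 1" | m where "n = Suc (Suc m)"
    by (metis One_nat_def not0_implies_Suc)
  then show ?thesis
  proof cases
    case 1
    have lg: "((\<lambda>x. ln_Gamma (x + 1)) has_real_derivative Digamma (x + 1)) (at x)"
      using assms by (auto intro!: derivative_eq_intros)
    have yl: "((\<lambda>x. (x + 1/2) * ln (x + 1/2)) has_real_derivative ln (x + 1/2) + 1) (at x)"
    proof -
      have "((\<lambda>y. y * ln y) has_real_derivative ln (x + 1/2) + 1) (at (x + 1/2))"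
        using assms by (auto intro!: derivative_eq_intros)
      then show ?thesis unfolding DERIV_shift .
    qed
    have "((\<lambda>x. ln_Gamma (x + 1) - (x + 1/2) * ln (x + 1/2) + x + 1/2 - ln (sqrt (2 * pi)) + a / (x + l) ^ 1)
        has_real_derivative Digamma (x + 1) - (ln (x + 1/2) + 1) + 1 + 0 - 0 + - (a * real 1 / (x + l) ^ Suc 1)) (at x)"
      using assms
      by (intro DERIV_add DERIV_diff lg yl DERIV_inverse_shift_power DERIV_ident DERIV_const) auto
    then have "((\<lambda>x. ln_Gamma (x + 1) - (x + 1/2) * ln (x + 1/2) + x + 1/2 - ln (sqrt (2 * pi)) + a / (x + l))
        has_real_derivative corrected_deriv a l (Suc 0) x) (at x)"
      by (simp add: power2_eq_square)
    then show ?thesis unfolding 1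
      by (rule has_field_derivative_transform_within_open[of _ _ _ "{0<..}"])
         (use assms in \<open>simp_all add: stirling_error_def ln_Gamma_real_pos\<close>)
  next
    case 2
    have "((\<lambda>x. Digamma (x + 1) - ln (x + 1/2) - a / (x + l)\<^sup>2)
        has_real_derivative Polygamma (Suc 0) (x + 1) - 1 / (x + 1/2) - - (a * real 2 / (x + l) ^ Suc 2)) (at x)"
      using assms
      by (intro DERIV_diff DERIV_inverse_shift_power polygamma)
         (auto intro!: derivative_eq_intros)
    moreover have "Polygamma (Suc 0) (x + 1) - 1 / (x + 1/2) - - (a * real 2 / (x + l) ^ Suc 2)
        = corrected_deriv a l (Suc (Suc 0)) x"
      by (simp add: numeral_3_eq_3 numeral_2_eq_2)
    ultimately show ?thesis unfolding 2 by simp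
  next
    case (3 m)
    let ?d = "Polygamma (Suc (Suc m)) (x + 1) - - ((-1) ^ m * fact m * real (Suc m) / (x + 1/2) ^ Suc (Suc m))
        + - (a * (-1) ^ m * fact (m + 2) * real (m + 3) / (x + l) ^ Suc (m + 3))"
    have "((\<lambda>x. Polygamma (Suc m) (x + 1) - (-1) ^ m * fact m / (x + 1/2) ^ Suc m
              + a * (-1) ^ m * fact (m + 2) / (x + l) ^ (m + 3)) has_real_derivative ?d) (at x)"
      using assms by (intro DERIV_add DERIV_diff DERIV_inverse_shift_power polygamma) auto
    moreover have "?d = corrected_deriv a l (Suc (Suc (Suc m))) x"
    proof -
      have f1: "fact (Suc m) = fact m * real (Suc m)" by simp
      have f2: "fact (Suc m + 2) = fact (m + 2) * real (m + 3)"
        by (simp add: algebra_simps)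
      have e: "Suc m + 3 = Suc (m + 3)" by simp
      show ?thesis
        unfolding corrected_deriv.simps f1 f2 e power_Suc[of "-1 :: real" m] by (simp only: algebra_simps)
    qed
    ultimately show ?thesis
      unfolding 3 corrected_deriv.simps(3)[of a l m] by (simp only:)
  qed
qed

section \<open>Unit differences\<close>

text \<open>The function whose Laplace transform is minus the Stirling error, by Binet's formula.\<close>

definition binet_kernel :: "real \<Rightarrow> real" where
  "binet_kernel t = (exp (- t / 2) - t / (exp t - 1)) / t\<^sup>2"

definition corrected_kernel :: "real \<Rightarrow> real \<Rightarrow> real \<Rightarrow> real" where
  "corrected_kernel a l t = a * exp (- l * t) - binet_kernel t"

text \<open>Euler's integral for \<open>n!\<close>, rescaled by \<open>t \<mapsto> c t\<close>.\<close>

lemma has_bochner_integral_power_exp: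
  fixes c :: real
  assumes "c > 0"
  shows "has_bochner_integral lborel (\<lambda>t. t ^ n * exp (- c * t) * indicator {0<..} t) (fact n / c ^ Suc n)"
proof -
  have "has_bochner_integral lborel
      (\<lambda>t. (c * t) ^ n * exp (- c * t) * indicator {0<..} (c * t)) (fact n / c)"
    using iffD1[OF lborel_has_bochner_integral_real_affine_iff[of c _ _ 0]
        has_bochner_integral_I0i_power_exp_m[of n]] assms
    by (simp add: divideR_right divide_inverse mult.commute)
  then have "has_bochner_integral lborel
      (\<lambda>t. 1 / c ^ n * ((c * t) ^ n * exp (- c * t) * indicator {0<..} (c * t)))
      (1 / c ^ n * (fact n / c))"
    by (rule has_bochner_integral_mult_right[rotated])
  moreover have "1 / c ^ n * ((c * t) ^ n * exp (- c * t) * indicator {0<..} (c * t))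
      = t ^ n * exp (- c * t) * indicator {0<..} t" for t :: real
    using assms by (auto simp: indicator_def power_mult_distrib zero_less_mult_iff)
  ultimately show ?thesis
    by (simp add: mult.commute)
qed

text \<open>
  The recurrence of the polygamma functions cancels the only non-rational term of
  the derivative, which is why orders from two on have a rational difference.
\<close>

lemma corrected_deriv_difference:
  fixes x l a :: real
  assumes "x > 0" "l \<ge> 0"
  shows "(-1) ^ n * (corrected_deriv a l (n + 2) x - corrected_deriv a l (n + 2) (x + 1)) =
     fact (n + 1) / (x + 1) ^ (n + 2) - fact n / (x + 1/2) ^ Suc n + fact n / (x + 3/2) ^ Suc n
     + a * (fact (n + 2) / (x + l) ^ (n + 3) - fact (n + 2) / (x + l + 1) ^ (n + 3))"
proof -
  have p: "Polygamma (Suc n) (x + 1 + 1) = Polygamma (Suc n) (x + 1)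
       - (-1) ^ n * fact (n + 1) / (x + 1) ^ (n + 2)"
    using Polygamma_plus1[of "x + 1" "Suc n"] assms by simp
  have sq: "(-1) ^ n * ((-1) ^ n * y) = y" for y :: real
    by (simp flip: mult.assoc power_mult_distrib)
  define A B C D E F where defs: "A = fact (n + 1) / (x + 1) ^ (n + 2)"
    "B = fact n / (x + 1/2) ^ Suc n" "C = fact n / (x + 3/2) ^ Suc n"
    "D = fact (n + 2) / (x + l) ^ (n + 3)" "E = fact (n + 2) / (x + l + 1) ^ (n + 3)"
    "F = Polygamma (Suc n) (x + 1)"
  have first: "corrected_deriv a l (n + 2) x = F - (-1) ^ n * B + a * (-1) ^ n * D"
    by (simp add: defs)
  have second: "corrected_deriv a l (n + 2) (x + 1)
      = (F - (-1) ^ n * A) - (-1) ^ n * C + a * (-1) ^ n * E"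
    using p by (simp add: defs add_ac)
  have "(-1) ^ n * (corrected_deriv a l (n + 2) x - corrected_deriv a l (n + 2) (x + 1))
     = (-1) ^ n * ((-1) ^ n * (A - B + C + a * (D - E)))"
    unfolding first second by (simp only: algebra_simps)
  then show ?thesis unfolding sq by (simp only: defs)
qed

text \<open>
  Each of the five rational terms is a Gamma integral.  Their integrands have the common factor
  \<open>t ^ n exp (- x t)\<close>, and multiplying \<open>\<phi> t\<close> by \<open>t\<^sup>2 (1 - exp (- t))\<close> clears its denominators to
  \<open>exp (- t / 2) - exp (- 3 t / 2) - t exp (- t)\<close>, so the integrands add up to the kernel.
\<close>

lemma corrected_deriv_difference_laplace:
  fixes x l a :: real
  assumes "x > 0" "l \<ge> 0"
  shows "has_bochner_integral lborel
     (\<lambda>t. t ^ (n + 2) * exp (- x * t) * (1 - exp (- t)) * corrected_kernel a l t * indicator {0<..} t)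
     ((-1) ^ n * (corrected_deriv a l (n + 2) x - corrected_deriv a l (n + 2) (x + 1)))"
proof -
  let ?I = "\<lambda>n c t. t ^ n * exp (- c * t) * indicator {0<..} t :: real"
  have kernel: "?I (n + 1) (x + 1) t - ?I n (x + 1/2) t + ?I n (x + 3/2) t
      + a * (?I (n + 2) (x + l) t - ?I (n + 2) (x + l + 1) t)
      = t ^ (n + 2) * exp (- x * t) * (1 - exp (- t)) * corrected_kernel a l t * indicator {0<..} t" for t
  proof (cases "t > 0")
    case True
    \<comment> \<open>In terms of \<open>p\<close> and \<open>q\<close> every exponential is a monomial, so the identity becomes algebraic.\<close>
    define p q where "p = exp (- (t / 2))" and "q = exp (- l * t)"
    have p: "0 < p" "p < 1" using True by (auto simp: p_def)
    have e1: "exp (- t) = p\<^sup>2" by (simp add: p_def flip: exp_double)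
    have e2: "exp t = 1 / p\<^sup>2" using e1 by (metis exp_minus inverse_eq_divide inverse_inverse_eq)
    have p2: "p\<^sup>2 < 1" using p by (simp add: power_less_one_iff)
    have frac: "t / (exp t - 1) = t * p\<^sup>2 / (1 - p\<^sup>2)"
      using p p2 unfolding e2 by (simp add: divide_simps)
    have b: "t\<^sup>2 * binet_kernel t * (1 - p\<^sup>2) = p - p ^ 3 - t * p\<^sup>2"
      unfolding binet_kernel_def frac using True p p2
      by (simp add: p_def[symmetric] field_simps power3_eq_cube power2_eq_square)
    have s: "exp (- (x + 1) * t) = exp (- x * t) * p\<^sup>2"
      "exp (- (x + 1/2) * t) = exp (- x * t) * p"
      "exp (- (x + 3/2) * t) = exp (- x * t) * p ^ 3"
      "exp (- (x + l) * t) = exp (- x * t) * q"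
      "exp (- (x + l + 1) * t) = exp (- x * t) * q * p\<^sup>2"
      by (simp_all add: p_def q_def algebra_simps flip: exp_add exp_of_nat_mult)
    have "t ^ (n + 2) * exp (- x * t) * (1 - exp (- t)) * corrected_kernel a l t
        = t ^ n * exp (- x * t) * (a * t\<^sup>2 * q * (1 - p\<^sup>2) - t\<^sup>2 * binet_kernel t * (1 - p\<^sup>2))"
      unfolding corrected_kernel_def e1 q_def by (simp add: algebra_simps power_add power2_eq_square)
    also have "\<dots> = t ^ n * exp (- x * t) * (a * t\<^sup>2 * q * (1 - p\<^sup>2) - (p - p ^ 3 - t * p\<^sup>2))"
      unfolding b ..
    finally show ?thesis using True
      unfolding s by (simp add: algebra_simps power_add power2_eq_square)
  qed simp
  have "has_bochner_integral lborel
    (\<lambda>t. ?I (n + 1) (x + 1) t - ?I n (x + 1/2) t + ?I n (x + 3/2) t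
      + a * (?I (n + 2) (x + l) t - ?I (n + 2) (x + l + 1) t))
    (fact (n + 1) / (x + 1) ^ Suc (n + 1) - fact n / (x + 1/2) ^ Suc n + fact n / (x + 3/2) ^ Suc n
     + a * (fact (n + 2) / (x + l) ^ Suc (n + 2) - fact (n + 2) / (x + l + 1) ^ Suc (n + 2)))"
    by (intro has_bochner_integral_add has_bochner_integral_diff has_bochner_integral_mult_right
        has_bochner_integral_power_exp) (use assms in auto)
  then show ?thesis
    unfolding kernel corrected_deriv_difference[OF assms] by (simp add: eval_nat_numeral)
qed

lemma corrected_deriv_difference_nonneg:
  fixes x l a s :: real
  assumes "x > 0" "l \<ge> 0" and kernel: "\<And>t. t > 0 \<Longrightarrow> 0 \<le> s * corrected_kernel a l t"
  shows "0 \<le> s * (-1) ^ n * (corrected_deriv a l (n + 2) x - corrected_deriv a l (n + 2) (x + 1))"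
proof -
  have "has_bochner_integral lborel
     (\<lambda>t. s * (t ^ (n + 2) * exp (- x * t) * (1 - exp (- t)) * corrected_kernel a l t * indicator {0<..} t))
     (s * ((-1) ^ n * (corrected_deriv a l (n + 2) x - corrected_deriv a l (n + 2) (x + 1))))"
    by (intro has_bochner_integral_mult_right corrected_deriv_difference_laplace assms)
  moreover have "0 \<le> s * (t ^ (n + 2) * exp (- x * t) * (1 - exp (- t)) * corrected_kernel a l t * indicator {0<..} t)" for t
  proof (cases "t > 0")
    case True
    then have "0 \<le> (t ^ (n + 2) * exp (- x * t) * (1 - exp (- t))) * (s * corrected_kernel a l t)"
      using kernel[OF True] by (intro mult_nonneg_nonneg[OF _ kernel[OF True]] mult_nonneg_nonneg) auto
    then show ?thesis using True by (simp add: mult_ac)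
  qed simp
  ultimately show ?thesis
    by (metis (no_types, lifting) mult.assoc has_bochner_integral_integral_eq Bochner_Integration.integral_nonneg)
qed

section \<open>Decay at infinity\<close>

text \<open>
  This replaces the summation of the telescoping series \<open>\<Sum>k. f (x + k) - f (x + k + 1)\<close>.
\<close>

lemma nonneg_if_decreasing_under_shift:
  fixes f :: "real \<Rightarrow> real"
  assumes "x > 0" and dec: "\<And>y. y > 0 \<Longrightarrow> f (y + 1) \<le> f y"
    and lim: "(\<lambda>k. f (x + real k)) \<longlonglongrightarrow> 0"
  shows "0 \<le> f x"
proof -
  have "decseq (\<lambda>k. f (x + real k))"
    using dec[of "x + real k" for k] \<open>x > 0\<close> by (intro decseq_SucI) (simp add: add_ac)
  from decseq_ge[OF this lim, of 0] show ?thesis by simp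
qed

text \<open>Shifting the argument by \<open>k\<close> leaves the tail, from index \<open>k\<close> on, of the defining series.\<close>

lemma Polygamma_shift_tendsto_0:
  fixes x :: real
  assumes "x > 0"
  shows "(\<lambda>k. Polygamma (Suc n) (x + real k)) \<longlonglongrightarrow> 0"
proof -
  let ?f = "\<lambda>i. inverse ((x + real i) ^ Suc (Suc n))"
  have summable: "summable ?f"
    using assms by (intro Polygamma_converges') auto
  have tail: "(\<Sum>i. inverse ((x + real k + real i) ^ Suc (Suc n))) = suminf ?f - sum ?f {..<k}" for k
    using suminf_minus_initial_segment[OF summable, of k] by (simp add: add_ac)
  have "(\<lambda>k. suminf ?f - sum ?f {..<k}) \<longlonglongrightarrow> suminf ?f - suminf ?f"
    by (intro tendsto_diff tendsto_const summable_LIMSEQ summable)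
  then have "(\<lambda>k. \<Sum>i. inverse ((x + real k + real i) ^ Suc (Suc n))) \<longlonglongrightarrow> 0"
    unfolding tail by simp
  then show ?thesis
    unfolding Polygamma_def by (auto intro!: tendsto_mult_right_zero)
qed

text \<open>
  The increment of \<open>ln \<Gamma>\<close> over \<open>[x, x + 1]\<close> is \<open>ln x\<close>, and by the mean value theorem it is a value
  of the increasing function \<open>Digamma\<close> on that interval.
\<close>

lemma ln_between_Digamma:
  fixes x :: real
  assumes "x > 0"
  shows "Digamma x \<le> ln x" "ln x \<le> Digamma (x + 1)"
proof -
  obtain y where y: "x < y" "y < x + 1" "ln_Gamma (x + 1) - ln_Gamma x = (x + 1 - x) * Digamma y"
    using MVT2[of x "x + 1" ln_Gamma Digamma] has_field_derivative_ln_Gamma_real assms by force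
  have "Gamma (x + 1) = x * Gamma x"
    using assms by (intro Gamma_plus1) (auto elim!: nonpos_Ints_cases)
  then have "ln_Gamma (x + 1) = ln x + ln_Gamma x"
    using assms Gamma_real_pos[OF assms] by (simp add: ln_Gamma_real_pos ln_mult_pos)
  then have "Digamma y = ln x" using y by simp
  moreover have "Digamma x \<le> Digamma y" "Digamma y \<le> Digamma (x + 1)"
    using y assms by (auto intro!: Digamma_real_mono)
  ultimately show "Digamma x \<le> ln x" "ln x \<le> Digamma (x + 1)" by simp_all
qed

lemma Digamma_minus_ln_tendsto_0:
  "((\<lambda>x::real. Digamma (x + 1) - ln (x + 1/2)) \<longlongrightarrow> 0) at_top"
proof (rule tendsto_sandwich)
  show "eventually (\<lambda>x::real. ln x - ln (x + 1/2) \<le> Digamma (x + 1) - ln (x + 1/2)) at_top"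
    using eventually_gt_at_top[of 0] by eventually_elim (simp add: ln_between_Digamma)
  show "eventually (\<lambda>x::real. Digamma (x + 1) - ln (x + 1/2) \<le> ln (x + 1) - ln (x + 1/2)) at_top"
    using eventually_gt_at_top[of 0] by eventually_elim (simp add: ln_between_Digamma)
  show "((\<lambda>x::real. ln x - ln (x + 1/2)) \<longlongrightarrow> 0) at_top"
    by real_asymp
  show "((\<lambda>x::real. ln (x + 1) - ln (x + 1/2)) \<longlongrightarrow> 0) at_top"
    by real_asymp
qed

lemma filterlim_shift_at_top: "filterlim (\<lambda>k. x + real k) at_top sequentially" for x :: real
  by real_asymp

lemma inverse_power_shift_tendsto_0:
  fixes x c d :: real
  assumes "m > 0"
  shows "(\<lambda>k. d / (x + real k + c) ^ m) \<longlonglongrightarrow> 0"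
proof -
  have "filterlim (\<lambda>k. (x + real k + c) ^ m) at_top sequentially"
    by (rule filterlim_pow_at_top[OF assms]) real_asymp
  then show ?thesis
    by (intro tendsto_divide_0[OF tendsto_const] filterlim_at_top_imp_at_infinity)
qed

lemma corrected_deriv_Suc_shift_tendsto_0:
  fixes x l a :: real
  assumes "x > 0"
  shows "(\<lambda>k. corrected_deriv a l (Suc n) (x + real k)) \<longlonglongrightarrow> 0"
proof (cases n)
  case 0
  have "(\<lambda>k. (Digamma (x + real k + 1) - ln (x + real k + 1/2)) - a / (x + real k + l)\<^sup>2) \<longlonglongrightarrow> 0 - 0"
    by (intro tendsto_diff inverse_power_shift_tendsto_0
        filterlim_compose[OF Digamma_minus_ln_tendsto_0 filterlim_shift_at_top]) simp
  then show ?thesis by (simp add: 0)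
next
  case (Suc m)
  have "(\<lambda>k. Polygamma (Suc m) (x + 1 + real k) - (-1) ^ m * fact m / (x + real k + 1/2) ^ Suc m
          + a * (-1) ^ m * fact (m + 2) / (x + real k + l) ^ (m + 3)) \<longlonglongrightarrow> 0 - 0 + 0"
    using assms
    by (intro tendsto_diff tendsto_add inverse_power_shift_tendsto_0 Polygamma_shift_tendsto_0) auto
  then show ?thesis by (simp add: Suc add_ac)
qed

text \<open>
  Orders from two on are handled by the unit differences.  The first derivative is monotone because
  the second one has a sign, so decay settles it as well.  Order zero is left out because the decay
  of the Stirling error is itself a consequence of this lemma.
\<close>

lemma corrected_deriv_Suc_sign:
  fixes x l a s :: real
  assumes "x > 0" "l \<ge> 0" and kernel: "\<And>t. t > 0 \<Longrightarrow> 0 \<le> s * corrected_kernel a l t"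
  shows "0 \<le> s * (-1) ^ Suc n * corrected_deriv a l (Suc n) x"
proof -
  have high: "0 \<le> s * (-1) ^ n * corrected_deriv a l (n + 2) y" if "y > 0" for n y
  proof (rule nonneg_if_decreasing_under_shift[OF that])
    show "s * (-1) ^ n * corrected_deriv a l (n + 2) (z + 1) \<le> s * (-1) ^ n * corrected_deriv a l (n + 2) z"
      if "z > 0" for z
      using corrected_deriv_difference_nonneg[OF that assms(2) kernel, of n] by (simp add: algebra_simps)
    show "(\<lambda>k. s * (-1) ^ n * corrected_deriv a l (n + 2) (y + real k)) \<longlonglongrightarrow> 0"
      using corrected_deriv_Suc_shift_tendsto_0[OF that, of a l "Suc n"]
      by (intro tendsto_mult_right_zero) simp
  qed
  show ?thesis
  proof (cases n)
    case 0
    have "0 \<le> (\<lambda>z. - s * corrected_deriv a l (Suc 0) z) x"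
    proof (rule nonneg_if_decreasing_under_shift[OF \<open>x > 0\<close>])
      fix y :: real assume "y > 0"
      have "((\<lambda>z. - s * corrected_deriv a l (Suc 0) z) has_real_derivative - s * corrected_deriv a l (Suc (Suc 0)) z) (at z)"
        if "z > 0" for z
        using corrected_deriv_has_derivative[OF that assms(2), of a "Suc 0"]
        by (intro DERIV_cmult)
      note deriv = this
      show "- s * corrected_deriv a l (Suc 0) (y + 1) \<le> - s * corrected_deriv a l (Suc 0) y"
      proof (intro DERIV_nonpos_imp_nonincreasing[of y "y + 1"] exI conjI)
        fix z assume "y \<le> z"
        then have "z > 0" using \<open>y > 0\<close> by simp
        then show "((\<lambda>z. - s * corrected_deriv a l (Suc 0) z) has_real_derivative - s * corrected_deriv a l (Suc (Suc 0)) z) (at z)"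
          by (rule deriv)
        show "- s * corrected_deriv a l (Suc (Suc 0)) z \<le> 0"
          using high[OF \<open>z > 0\<close>, of 0] by (simp add: numeral_2_eq_2)
      qed simp
    next
      show "(\<lambda>k. - s * corrected_deriv a l (Suc 0) (x + real k)) \<longlonglongrightarrow> 0"
        using corrected_deriv_Suc_shift_tendsto_0[OF \<open>x > 0\<close>, of a l 0]
        by (intro tendsto_mult_right_zero) simp
    qed
    then show ?thesis by (simp add: 0)
  next
    case (Suc m)
    then show ?thesis using high[OF \<open>x > 0\<close>, of m] by simp
  qed
qed

lemma corrected_decreasing:
  fixes x y l a s :: real
  assumes "x > 0" "x \<le> y" "l \<ge> 0" and kernel: "\<And>t. t > 0 \<Longrightarrow> 0 \<le> s * corrected_kernel a l t"
  shows "s * corrected_deriv a l 0 y \<le> s * corrected_deriv a l 0 x"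
proof (rule DERIV_nonpos_imp_nonincreasing[OF \<open>x \<le> y\<close>])
  fix z assume "x \<le> z" "z \<le> y"
  then have "z > 0" using \<open>x > 0\<close> by simp
  then show "\<exists>d. ((\<lambda>z. s * corrected_deriv a l 0 z) has_real_derivative d) (at z) \<and> d \<le> 0"
    using DERIV_cmult[OF corrected_deriv_has_derivative[OF \<open>z > 0\<close> assms(3), of a 0], of s]
      corrected_deriv_Suc_sign[OF \<open>z > 0\<close> assms(3) kernel, of 0]
    by force
qed

section \<open>Kernel estimates\<close>

text \<open>From \<open>cosh u - 1 = 2 sinh\<^sup>2 (u / 2)\<close> and \<open>sinh v \<ge> v\<close>.\<close>

lemma cosh_ge_quadratic: "1 + u\<^sup>2 / 2 \<le> cosh u" if "u \<ge> 0" for u :: real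
proof -
  have "u / 2 \<le> sinh (u / 2)"
  proof -
    have "sinh 0 - 0 \<le> sinh (u / 2) - u / 2"
    proof (rule DERIV_nonneg_imp_nondecreasing[where f = "\<lambda>v. sinh v - v" and a = 0 and b = "u / 2"])
      fix v :: real
      have "((\<lambda>v. sinh v - v) has_real_derivative cosh v - 1) (at v)"
        by (auto intro!: derivative_eq_intros)
      then show "\<exists>d. ((\<lambda>v. sinh v - v) has_real_derivative d) (at v) \<and> 0 \<le> d"
        using cosh_real_ge_1[of v] by (intro exI[of _ "cosh v - 1"]) simp
    qed (use that in simp)
    then show ?thesis by simp
  qed
  then have "(u / 2)\<^sup>2 \<le> (sinh (u / 2))\<^sup>2"
    using that by (intro power_mono) auto
  moreover have "cosh u = 1 + 2 * (sinh (u / 2))\<^sup>2"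
    using cosh_double[of "u / 2"] cosh_square_eq[of "u / 2"] by simp
  ultimately show ?thesis by (simp add: power2_eq_square)
qed

lemma sinh_ge_cubic: "u + u ^ 3 / 6 \<le> sinh u" if "u \<ge> 0" for u :: real
proof -
  have "sinh 0 - 0 - 0 ^ 3 / 6 \<le> sinh u - u - u ^ 3 / 6"
  proof (rule DERIV_nonneg_imp_nondecreasing[OF that])
    fix v :: real assume "0 \<le> v"
    moreover have "((\<lambda>u. sinh u - u - u ^ 3 / 6) has_real_derivative cosh v - 1 - v\<^sup>2 / 2) (at v)"
      by (auto intro!: derivative_eq_intros)
    ultimately show "\<exists>d. ((\<lambda>u. sinh u - u - u ^ 3 / 6) has_real_derivative d) (at v) \<and> 0 \<le> d"
      using cosh_ge_quadratic[of v] by force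
  qed
  then show ?thesis by simp
qed

text \<open>
  In this form the comparison with exponentials becomes a comparison of \<open>u / sinh u\<close>, where
  \<open>u = t / 2\<close>, with polynomials.
\<close>

lemma binet_kernel_sinh:
  assumes "t > 0"
  shows "binet_kernel t = exp (- t / 2) * (1 - (t / 2) / sinh (t / 2)) / t\<^sup>2"
proof -
  have "exp t = exp (t / 2) * exp (t / 2)" by (simp flip: exp_add)
  moreover have "1 < exp (t / 2)" using assms by simp
  ultimately have "t / (exp t - 1) = exp (- t / 2) * ((t / 2) / sinh (t / 2))"
    by (simp add: sinh_field_def exp_minus divide_simps)
  then show ?thesis
    by (simp add: binet_kernel_def algebra_simps)
qed

lemma binet_kernel_pos: "0 < binet_kernel t" if "t > 0" for t
proof -
  have "t / 2 < sinh (t / 2)"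
    using sinh_ge_cubic[of "t / 2"] zero_less_power[of "t / 2" 3] that by linarith
  then have "(t / 2) / sinh (t / 2) < 1" using that by simp
  then show ?thesis
    using that unfolding binet_kernel_sinh[OF that] by (intro divide_pos_pos mult_pos_pos) auto
qed

lemma sinh_le_mult_cosh: "sinh u \<le> u * cosh u" if "u \<ge> 0" for u :: real
proof -
  have "0 * cosh 0 - sinh 0 \<le> u * cosh u - sinh u"
  proof (rule DERIV_nonneg_imp_nondecreasing[OF that])
    fix v :: real assume "0 \<le> v"
    moreover have "((\<lambda>u. u * cosh u - sinh u) has_real_derivative v * sinh v) (at v)"
      by (auto intro!: derivative_eq_intros)
    ultimately show "\<exists>d. ((\<lambda>u. u * cosh u - sinh u) has_real_derivative d) (at v) \<and> 0 \<le> d"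
      by (intro exI[of _ "v * sinh v"]) simp
  qed
  then show ?thesis by simp
qed

text \<open>
  With \<open>v = u / 2\<close>, the derivative of \<open>u - (1 - u\<^sup>2 / 6) sinh u\<close> is
  \<open>2/3 v\<^sup>2 cosh u + 4/3 v sinh v cosh v - 2 sinh\<^sup>2 v\<close>.  As \<open>sinh v \<le> v cosh v\<close> and
  \<open>cosh\<^sup>2 v \<le> cosh u\<close>, the first two terms dominate \<open>2/3 sinh\<^sup>2 v\<close> and \<open>4/3 sinh\<^sup>2 v\<close>.
\<close>

lemma sinh_quadratic_le: "(1 - u\<^sup>2 / 6) * sinh u \<le> u" if "u \<ge> 0" for u :: real
proof -
  have "0 - (1 - 0\<^sup>2 / 6) * sinh 0 \<le> u - (1 - u\<^sup>2 / 6) * sinh u"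
  proof (rule DERIV_nonneg_imp_nondecreasing[OF that])
    fix w :: real assume "0 \<le> w"
    define v where "v = w / 2"
    have w: "w = 2 * v" and v: "v \<ge> 0" using \<open>0 \<le> w\<close> by (simp_all add: v_def)
    have "((\<lambda>u. u - (1 - u\<^sup>2 / 6) * sinh u) has_real_derivative
        1 - (1 - w\<^sup>2 / 6) * cosh w + w / 3 * sinh w) (at w)"
      by (auto intro!: derivative_eq_intros simp: algebra_simps)
    moreover have "0 \<le> 1 - (1 - w\<^sup>2 / 6) * cosh w + w / 3 * sinh w"
    proof -
      have cosh2: "cosh w = 1 + 2 * (sinh v)\<^sup>2"
        unfolding w cosh_double cosh_square_eq by simp
      have base: "sinh v \<le> v * cosh v" by (rule sinh_le_mult_cosh[OF v])
      have a: "sinh v * sinh v \<le> sinh v * (v * cosh v)"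
        using base v by (intro mult_left_mono) auto
      have "(sinh v)\<^sup>2 \<le> (v * cosh v)\<^sup>2"
        using base v by (intro power_mono) auto
      also have "\<dots> \<le> v\<^sup>2 * cosh w"
        unfolding w cosh_double by (simp add: power_mult_distrib algebra_simps)
      finally have b: "(sinh v)\<^sup>2 \<le> v\<^sup>2 * cosh w" .
      have "1 - (1 - w\<^sup>2 / 6) * cosh w + w / 3 * sinh w
          = 2/3 * (v\<^sup>2 * cosh w) + 4/3 * (sinh v * (v * cosh v)) - (cosh w - 1)"
        unfolding w sinh_double by (simp add: algebra_simps power2_eq_square)
      then show ?thesis using a b cosh2 by (simp add: power2_eq_square)
    qed
    ultimately show "\<exists>d. ((\<lambda>u. u - (1 - u\<^sup>2 / 6) * sinh u) has_real_derivative d) (at w) \<and> 0 \<le> d"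
      by blast
  qed
  then show ?thesis by simp
qed

text \<open>
  The extreme case \<open>l = 1/2\<close> is \<open>u / sinh u \<ge> 1 - u\<^sup>2 / 6\<close>, since the factor \<open>exp (- t / 2)\<close> cancels.
\<close>

lemma binet_kernel_le: "binet_kernel t \<le> 1 / 24 * exp (- l * t)" if "t > 0" "l \<le> 1/2" for t l
proof -
  define u where "u = t / 2"
  have u: "u > 0" and t: "t = 2 * u" using that by (simp_all add: u_def)
  have "1 - u\<^sup>2 / 6 \<le> u / sinh u"
    using u sinh_quadratic_le[of u] by (simp add: pos_le_divide_eq)
  then have "(1 - u / sinh u) / t\<^sup>2 \<le> 1 / 24"
    using u by (simp add: t pos_divide_le_eq power_mult_distrib)
  then have "binet_kernel t \<le> exp (- t / 2) * (1 / 24)"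
    unfolding binet_kernel_sinh[OF that(1)] u_def[symmetric] times_divide_eq_right[symmetric]
    by (intro mult_left_mono) auto
  also have "\<dots> \<le> exp (- l * t) * (1 / 24)"
    using that mult_right_mono[of l "1/2" t] by (intro mult_right_mono) auto
  finally show ?thesis by simp
qed

text \<open>
  For \<open>l = 3/2\<close> the claim is \<open>u\<^sup>2 exp (- 2 u) sinh u \<le> 6 (sinh u - u)\<close>.  The quantity \<open>u ^ 3\<close> lies
  between the two sides, because \<open>exp (- u) sinh u = (1 - exp (- 2 u)) / 2 \<le> u\<close> and
  \<open>sinh u \<ge> u + u ^ 3 / 6\<close>.
\<close>

lemma binet_kernel_ge: "1 / 24 * exp (- l * t) \<le> binet_kernel t" if "t > 0" "l \<ge> 3/2" for t l
proof -
  define u where "u = t / 2"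
  have u: "u > 0" and t: "t = 2 * u" using that by (simp_all add: u_def)
  have "exp (- (2 * u)) * sinh u \<le> exp (- u) * sinh u"
    using u by (intro mult_right_mono) auto
  also have "\<dots> = (1 - exp (- (2 * u))) / 2"
    by (simp add: sinh_field_def algebra_simps flip: exp_add)
  also have "\<dots> \<le> u"
    using exp_ge_add_one_self[of "- (2 * u)"] by simp
  finally have "u\<^sup>2 * (exp (- (2 * u)) * sinh u) \<le> u\<^sup>2 * u"
    by (intro mult_left_mono) auto
  also have "\<dots> \<le> 6 * (sinh u - u)"
    using sinh_ge_cubic[of u] u by (simp add: power2_eq_square power3_eq_cube)
  finally have "1 / 24 * exp (- t) \<le> (1 - u / sinh u) / t\<^sup>2"
    using u by (simp add: t field_simps power2_eq_square)
  then have "exp (- t / 2) * (1 / 24 * exp (- t)) \<le> binet_kernel t"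
    unfolding binet_kernel_sinh[OF that(1)] u_def[symmetric] times_divide_eq_right[symmetric]
    by (intro mult_left_mono) auto
  moreover have "exp (- l * t) \<le> exp (- t / 2) * exp (- t)"
    using that mult_right_mono[of "3/2" l t] by (simp flip: exp_add)
  ultimately show ?thesis by simp
qed

text \<open>
  The argument of the logarithm in the threshold is \<open>24 \<phi> t\<close>, which is positive, so taking
  exponentials undoes the logarithm.
\<close>

lemma threshold_le_iff:
  "threshold \<le> ereal l \<longleftrightarrow> (\<forall>t>0. 1 / 24 * exp (- l * t) \<le> binet_kernel t)"
proof -
  let ?g = "\<lambda>t. 1 / t * ln (24 / t\<^sup>2 * (1 / exp (t / 2) - t / (exp t - 1)))"
  have "threshold \<le> ereal l \<longleftrightarrow> ereal (- l) \<le> (INF t\<in>{0<..}. ereal (?g t))"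
    unfolding threshold_def by (subst ereal_uminus_le_reorder) (simp only: uminus_ereal.simps)
  also have "\<dots> \<longleftrightarrow> (\<forall>t>0. - l \<le> ?g t)"
    unfolding le_INF_iff ereal_less_eq by (simp only: greaterThan_iff Ball_def)
  also have "\<dots> \<longleftrightarrow> (\<forall>t>0. 1 / 24 * exp (- l * t) \<le> binet_kernel t)"
  proof (rule all_cong)
    fix t :: real assume t: "0 < t"
    have arg: "24 / t\<^sup>2 * (1 / exp (t / 2) - t / (exp t - 1)) = 24 * binet_kernel t"
      unfolding binet_kernel_def minus_divide_left[symmetric] exp_minus inverse_eq_divide by simp
    have "- l \<le> ?g t \<longleftrightarrow> - l * t \<le> ln (24 * binet_kernel t)"
      unfolding arg using t by (simp only: mult.commute[of "1 / t"] times_divide_eq_right mult_1_right pos_le_divide_eq)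
    also have "\<dots> \<longleftrightarrow> exp (- l * t) \<le> 24 * binet_kernel t"
      using binet_kernel_pos[OF t] by (intro ln_ge_iff) simp
    also have "\<dots> \<longleftrightarrow> 1 / 24 * exp (- l * t) \<le> binet_kernel t"
      by linarith
    finally show "- l \<le> ?g t \<longleftrightarrow> 1 / 24 * exp (- l * t) \<le> binet_kernel t" .
  qed
  finally show ?thesis .
qed

section \<open>Stirling's formula\<close>

lemma Gamma_duplication_real:
  fixes x :: real
  assumes "x > 0"
  shows "Gamma x * Gamma (x + 1/2) = exp ((1 - 2 * x) * ln 2) * sqrt pi * Gamma (2 * x)"
proof -
  have "complex_of_real x \<notin> \<int>\<^sub>\<le>\<^sub>0" "complex_of_real (x + 1/2) \<notin> \<int>\<^sub>\<le>\<^sub>0"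
    using assms by (subst of_real_in_nonpos_Ints_iff; auto elim!: nonpos_Ints_cases)+
  then have "complex_of_real x \<notin> \<int>\<^sub>\<le>\<^sub>0" "complex_of_real x + 1/2 \<notin> \<int>\<^sub>\<le>\<^sub>0"
    by simp_all
  from Gamma_legendre_duplication[OF this]
  have "complex_of_real (Gamma x * Gamma (x + 1/2))
      = complex_of_real (exp ((1 - 2 * x) * ln 2) * sqrt pi * Gamma (2 * x))"
    by (simp add: Gamma_complex_of_real[symmetric] exp_of_real[symmetric])
  then show ?thesis by (simp only: of_real_eq_iff)
qed

text \<open>
  Here the duplication formula is taken at \<open>x + 1\<close>: its three Gamma values are those in the Stirling
  errors at \<open>x\<close>, \<open>x + 1/2\<close> and \<open>2 x + 1\<close>, so only elementary terms remain.
\<close>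

lemma stirling_error_duplication:
  fixes x :: real
  assumes "x > 0"
  shows "stirling_error x + stirling_error (x + 1/2) - stirling_error (2 * x + 1) =
    (2 * x + 3/2) * ln (2 * x + 3/2) - (x + 1/2) * ln (x + 1/2) - (x + 1) * ln (x + 1)
    - (2 * x + 3/2) * ln 2"
proof -
  have pos: "Gamma (x + 1) > 0" "Gamma (x + 3/2) > 0" "Gamma (2 * x + 2) > 0"
    using assms by (auto intro!: Gamma_real_pos)
  have "ln (Gamma (x + 1) * Gamma (x + 3/2)) = ln (exp ((- 1 - 2 * x) * ln 2) * sqrt pi * Gamma (2 * x + 2))"
    using Gamma_duplication_real[of "x + 1"] assms by (simp add: algebra_simps)
  then have "ln (Gamma (x + 1)) + ln (Gamma (x + 3/2)) = (- 1 - 2 * x) * ln 2 + ln (sqrt pi) + ln (Gamma (2 * x + 2))"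
    using pos by (simp add: ln_mult)
  moreover have "ln (sqrt (2 * pi)) = ln (sqrt pi) + ln 2 / 2"
    by (simp add: real_sqrt_mult ln_mult ln_sqrt)
  ultimately show ?thesis
    unfolding stirling_error_def by (simp add: algebra_simps)
qed

text \<open>
  The Stirling error increases because \<open>\<phi>\<close> is positive, and its sum with \<open>1 / (24 (x + 1/2))\<close>
  decreases because of \<open>binet_kernel_le\<close>.  Together these bound the Stirling error from above.
\<close>

lemma stirling_error_mono: "stirling_error x \<le> stirling_error y" if "0 < x" "x \<le> y"
  using corrected_decreasing[of x y 0 "-1" 0] that
  by (simp add: corrected_kernel_def less_imp_le[OF binet_kernel_pos])

lemma stirling_error_le: "stirling_error y \<le> stirling_error x + 1 / 24 / (x + 1/2)"
  if "0 < x" "x \<le> y"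
proof -
  have "stirling_error y + 1 / 24 / (y + 1/2) \<le> stirling_error x + 1 / 24 / (x + 1/2)"
    using corrected_decreasing[of x y "1/2" 1 "1/24"] binet_kernel_le[of _ "1/2"] that
    by (simp add: corrected_kernel_def)
  moreover have "0 \<le> 1 / 24 / (y + 1/2)" using that by simp
  ultimately show ?thesis by linarith
qed

text \<open>
  Being increasing and bounded, the Stirling error has a limit \<open>c\<close>.  The left-hand side of the duplication
  identity tends to \<open>c + c - c = c\<close>, and its right-hand side to \<open>0\<close>.
\<close>

lemma stirling_error_tendsto_0: "(stirling_error \<longlongrightarrow> 0) at_top"
proof -
  let ?c = "SUP x\<in>{1..}. stirling_error x"
  have bdd: "bdd_above (stirling_error ` {1..})"
    using stirling_error_le[of 1] by (intro bdd_aboveI2[where M = "stirling_error 1 + 1 / 24 / (1 + 1/2)"]) simp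
  have lim: "(stirling_error \<longlongrightarrow> ?c) at_top"
  proof (rule increasing_tendsto)
    show "eventually (\<lambda>x. stirling_error x \<le> ?c) at_top"
      using eventually_ge_at_top[of 1] by eventually_elim (auto intro!: cSUP_upper bdd)
    fix b assume "b < ?c"
    then obtain z where z: "z \<ge> 1" "b < stirling_error z"
      using less_cSUP_iff[OF _ bdd] by auto
    show "eventually (\<lambda>x. b < stirling_error x) at_top"
      using eventually_ge_at_top[of z]
      by eventually_elim (use z stirling_error_mono[of z] in force)
  qed
  have "((\<lambda>x. stirling_error x + stirling_error (x + 1/2) - stirling_error (2 * x + 1)) \<longlongrightarrow> ?c + ?c - ?c) at_top"
    by (intro tendsto_diff tendsto_add lim filterlim_compose[OF lim]) real_asymp+
  moreover have "((\<lambda>x. stirling_error x + stirling_error (x + 1/2) - stirling_error (2 * x + 1)) \<longlongrightarrow> 0) at_top"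
  proof (rule Lim_transform_eventually)
    show "((\<lambda>x::real. (2 * x + 3/2) * ln (2 * x + 3/2) - (x + 1/2) * ln (x + 1/2) - (x + 1) * ln (x + 1)
      - (2 * x + 3/2) * ln 2) \<longlongrightarrow> 0) at_top"
      by real_asymp
    show "eventually (\<lambda>x. (2 * x + 3/2) * ln (2 * x + 3/2) - (x + 1/2) * ln (x + 1/2) - (x + 1) * ln (x + 1)
      - (2 * x + 3/2) * ln 2 = stirling_error x + stirling_error (x + 1/2) - stirling_error (2 * x + 1)) at_top"
      using eventually_gt_at_top[of 0] by eventually_elim (simp add: stirling_error_duplication)
  qed
  ultimately have "?c + ?c - ?c = 0"
    by (rule tendsto_unique[rotated]) simp
  then show ?thesis using lim by simp
qed

section \<open>Complete monotonicity\<close>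

lemma corrected_completely_monotonic:
  fixes l a s :: real
  assumes "l \<ge> 0" and kernel: "\<And>t. t > 0 \<Longrightarrow> 0 \<le> s * corrected_kernel a l t"
  shows "completely_monotonic_on {0<..} (\<lambda>x. s * corrected_deriv a l 0 x)"
  unfolding completely_monotonic_on_def
proof (intro exI[of _ "\<lambda>n x. s * corrected_deriv a l n x"] conjI allI ballI)
  fix n and x :: real assume "x \<in> {0<..}"
  then have x: "x > 0" by simp
  show "((\<lambda>x. s * corrected_deriv a l n x) has_real_derivative s * corrected_deriv a l (Suc n) x)
      (at x within {0<..})"
    by (rule has_field_derivative_at_within[OF DERIV_cmult[OF corrected_deriv_has_derivative[OF x assms(1)]]])
  show "0 \<le> (-1) ^ n * (s * corrected_deriv a l n x)"
  proof (cases n)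
    case 0
    have "0 \<le> s * corrected_deriv a l 0 x"
    proof (rule nonneg_if_decreasing_under_shift[OF x])
      show "s * corrected_deriv a l 0 (y + 1) \<le> s * corrected_deriv a l 0 y" if "y > 0" for y
        using that by (intro corrected_decreasing assms) auto
      have "(\<lambda>k. stirling_error (x + real k) + a / (x + real k + l) ^ 1) \<longlonglongrightarrow> 0 + 0"
        by (intro tendsto_add inverse_power_shift_tendsto_0
            filterlim_compose[OF stirling_error_tendsto_0 filterlim_shift_at_top]) simp
      then show "(\<lambda>k. s * corrected_deriv a l 0 (x + real k)) \<longlonglongrightarrow> 0"
        by (intro tendsto_mult_right_zero) simp
    qed
    then show ?thesis by (simp add: 0)
  next
    case (Suc m)
    then show ?thesis using corrected_deriv_Suc_sign[OF x assms, of m] by (simp add: mult_ac)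
  qed
qed simp

text \<open>
  Derivatives on an open set are unique, so the sign condition may be tested on any given
  sequence of successive derivatives.
\<close>

lemma completely_monotonic_on_derivative_sign:
  assumes cm: "completely_monotonic_on I f" and "open I"
    and D0: "\<And>x. x \<in> I \<Longrightarrow> D 0 x = f x"
    and DS: "\<And>n x. x \<in> I \<Longrightarrow> (D n has_real_derivative D (Suc n) x) (at x)"
    and "x \<in> I"
  shows "0 \<le> (-1) ^ n * D n x"
proof -
  have eq: "(deriv ^^ n) f y = D n y" if "y \<in> I" for n y
    using that
  proof (induction n arbitrary: y)
    case 0
    then show ?case using D0 by simp
  next
    case (Suc n)
    have "((deriv ^^ n) f has_real_derivative D (Suc n) y) (at y)"
      by (rule has_field_derivative_transform_within_open[OF DS[OF Suc.prems] \<open>open I\<close> Suc.prems])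
         (simp add: Suc.IH)
    then show ?case by (simp add: DERIV_imp_deriv)
  qed
  show ?thesis
    using cm \<open>x \<in> I\<close> unfolding completely_monotonic_on_open_iff[OF \<open>open I\<close>] by (simp add: eq)
qed

text \<open>
  The expression is \<open>H'' x - H'' (x + 1)\<close>.  Its terms of order up to \<open>x ^ -4\<close> cancel, which is the
  reason for the constant \<open>1/24\<close>; scaling by \<open>x ^ 5\<close> isolates the first one that depends on \<open>l\<close>.
\<close>

lemma second_difference_eventually_neg:
  fixes l :: real
  assumes "l > 1/2"
  shows "eventually (\<lambda>x. 1 / (x + 1)\<^sup>2 - 1 / (x + 1/2) + 1 / (x + 3/2)
     + 1/24 * (2 / (x + l) ^ 3 - 2 / (x + l + 1) ^ 3) < 0) at_top"
proof -
  have "((\<lambda>x. x ^ 5 * (1 / (x + 1)\<^sup>2 - 1 / (x + 1/2) + 1 / (x + 3/2)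
     + 1/24 * (2 / (x + l) ^ 3 - 2 / (x + l + 1) ^ 3))) \<longlongrightarrow> 1/2 - l) at_top"
    by real_asymp (simp add: field_simps)
  then have "eventually (\<lambda>x. x ^ 5 * (1 / (x + 1)\<^sup>2 - 1 / (x + 1/2) + 1 / (x + 3/2)
     + 1/24 * (2 / (x + l) ^ 3 - 2 / (x + l + 1) ^ 3)) < 0) at_top"
    using assms by (intro order_tendstoD(2)) auto
  then show ?thesis
    using eventually_gt_at_top[of 0]
    by eventually_elim (simp add: mult_less_0_iff)
qed

lemma H_not_completely_monotonic:
  fixes l :: real
  assumes "l > 1/2"
  shows "\<not> completely_monotonic_on {0<..} (H l)"
proof
  assume cm: "completely_monotonic_on {0<..} (H l)"
  let ?D = "corrected_deriv (1/24) l"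
  have sign: "0 \<le> (-1) ^ n * ?D n x" if "x > 0" for n x
  proof (rule completely_monotonic_on_derivative_sign[OF cm, where D = ?D])
    show "(?D n has_real_derivative ?D (Suc n) y) (at y)" if "y \<in> {0<..}" for n y
      using that assms by (intro corrected_deriv_has_derivative) auto
  qed (use that in \<open>simp_all only: H_eq_corrected open_greaterThan greaterThan_iff\<close>)
  obtain x where x: "x > 0" and neg: "1 / (x + 1)\<^sup>2 - 1 / (x + 1/2) + 1 / (x + 3/2)
     + 1/24 * (2 / (x + l) ^ 3 - 2 / (x + l + 1) ^ 3) < 0"
    using eventually_happens[OF eventually_conj[OF eventually_gt_at_top[of 0]
          second_difference_eventually_neg[OF assms]]] by auto
  have "?D 2 (x + 1) \<le> ?D 2 x"
  proof (rule DERIV_nonpos_imp_nonincreasing[where f = "?D 2"])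
    fix z assume "x \<le> z"
    then have "z > 0" using x by linarith
    have "(?D 2 has_real_derivative ?D (Suc 2) z) (at z)"
      using \<open>z > 0\<close> assms by (intro corrected_deriv_has_derivative) auto
    moreover have "?D (Suc 2) z \<le> 0"
      using sign[OF \<open>z > 0\<close>, of "Suc 2"] by (simp del: corrected_deriv.simps)
    ultimately show "\<exists>d. (?D 2 has_real_derivative d) (at z) \<and> d \<le> 0"
      by blast
  qed simp
  moreover have "?D 2 x - ?D 2 (x + 1) = 1 / (x + 1)\<^sup>2 - 1 / (x + 1/2) + 1 / (x + 3/2)
     + 1/24 * (2 / (x + l) ^ 3 - 2 / (x + l + 1) ^ 3)"
    using corrected_deriv_difference[of x l 0 "1/24"] x assms
    by (simp del: corrected_deriv.simps add: numeral_2_eq_2)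
  ultimately show False using neg by linarith
qed

theorem theorem1:
  fixes l :: real
  assumes "l \<ge> 0"
  shows "(completely_monotonic_on {0<..} (H l) \<longleftrightarrow> 0 \<le> l \<and> l \<le> 1/2) \<and>
         (ereal l \<ge> threshold \<longrightarrow> completely_monotonic_on {0<..} (\<lambda>x. - H l x)) \<and>
         (l \<ge> 3/2 \<longrightarrow> ereal l \<ge> threshold \<and> completely_monotonic_on {0<..} (\<lambda>x. - H l x))"
proof -
  have pos: "completely_monotonic_on {0<..} (H l)" if "l \<le> 1/2"
    using corrected_completely_monotonic[of l 1 "1/24"] assms binet_kernel_le[OF _ that]
    by (simp add: corrected_kernel_def H_eq_corrected[abs_def])
  have neg: "completely_monotonic_on {0<..} (\<lambda>x. - H l x)" if "threshold \<le> ereal l"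
    using corrected_completely_monotonic[of l "-1" "1/24"] assms that
    unfolding threshold_le_iff
    by (simp add: corrected_kernel_def H_eq_corrected[abs_def])
  have "threshold \<le> ereal l" if "l \<ge> 3/2"
    unfolding threshold_le_iff using binet_kernel_ge that by blast
  then show ?thesis
    using pos neg H_not_completely_monotonic[of l] assms by fastforce
qed

end
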